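(* Let $\alpha,\beta,\gamma,\delta\in\mathbb{R}$ with $\alpha+\delta\neq0$ and $\alpha\gamma-\beta\delta=0$, and let $(G_6,g,J)$ be the connected, simply connected three-dimensional Lie group with left-invariant Lorentzian metric $g$ whose Lie algebra $\mathfrak{g}$ has a pseudo-orthonormal basis $\{e_1,e_2,e_3\}$ with $e_3$ timelike such that $$[e_1,e_2]=\alpha e_2+\beta e_3,\quad [e_1,e_3]=\gamma e_2+\delta e_3,\quad [e_2,e_3]=0,$$ equipped with the product structure $Je_1=e_1$, $Je_2=e_2$, $Je_3=-e_3$. Let $c\in\mathbb{R}$. Then $(G_6,g,J)$ is a second kind algebraic Wanas soliton associated to the canonical connection $\nabla^0$ with constant $c$ (i.e. $\widetilde{\mathrm{Wan}}^0=c\,\mathrm{Id}+D$ with $D$ a derivation of $\mathfrak g$) if and only if one of the following holds: (i) $\alpha\neq0$, $\beta=\gamma=\delta=0$, $\alpha^2+c=0$; in particular $De_1=0$, $De_2=0$, $De_3=\alpha^2e_3$. (ii) $\beta=\gamma=0$, $\alpha^2+\delta^2+c=0$, $\delta\neq0$, $\alpha+\delta\neq0$; in particular $De_1=0$, $De_2=\delta^2e_2$, $De_3=(\alpha^2+\delta^2)e_3$. (iii) $\beta\neq0$, $\delta\neq0$, $\gamma=-\beta$, $\delta=-\alpha$, $\alpha^2=\beta^2$, $\alpha^2+c=0$; in particular $De_1=0$, $De_2=-\alpha^2e_2-\alpha\beta e_3$, $De_3=\alpha\beta e_2+\alpha^2e_3$.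
   Context: Pseudo-orthonormal with $e_3$ timelike means $g(e_1,e_1)=g(e_2,e_2)=1$, $g(e_3,e_3)=-1$, $g(e_i,e_j)=0$ for $i\ne j$. All tensors are left-invariant and evaluated on the Lie algebra $\mathfrak{g}$ of left-invariant vector fields. Let $\nabla$ be the Levi-Civita connection of $g$, and let $J$ be the product structure given in the claim, with $(\nabla_XJ)Y=\nabla_X(JY)-J(\nabla_XY)$. Canonical connection: $\nabla^0_XY=\nabla_XY-\frac12(\nabla_XJ)JY$. Curvature: $R^0(X,Y)Z=\nabla^0_X\nabla^0_YZ-\nabla^0_Y\nabla^0_XZ-\nabla^0_{[X,Y]}Z$. Torsion: $T^0(X,Y)=\nabla^0_XY-\nabla^0_YX-[X,Y]$. $A^0(X,Y)Z=T^0(T^0(X,Y),Z)$, and the Wanas tensor is $W^0(X,Y)Z=R^0(X,Y)Z-A^0(X,Y)Z$. $w^0(X,Y)=-g(W^0(X,e_1)Y,e_1)-g(W^0(X,e_2)Y,e_2)+g(W^0(X,e_3)Y,e_3)$. $\widetilde w^0(X,Y)=\frac12\big(w^0(X,Y)+w^0(Y,X)\big)$, and the operator $\widetilde{\mathrm{Wan}}^0:\mathfrak g\to\mathfrak g$ is defined by $\widetilde w^0(X,Y)=g(\widetilde{\mathrm{Wan}}^0(X),Y)$. A derivation of $\mathfrak g$ is a linear map $D$ with $D[X,Y]=[DX,Y]+[X,DY]$ for all $X,Y\in\mathfrak g$. $(G_6,g,J)$ is a second kind algebraic Wanas soliton associated to $\nabla^0$ (with constant $c$) if $\widetilde{\mathrm{Wan}}^0=c\,\mathrm{Id}+D$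 for the real number $c$ and a derivation $D$ of $\mathfrak g$. *)

theory Defs
  imports "HOL-Analysis.Analysis"
begin

text \<open>
  A connected, simply connected Lie group with left-invariant metric and product structure is
  represented by its Lie algebra of left-invariant vector fields (a real vector space \<open>'a\<close> with
  bracket \<open>br\<close>) together with the induced form \<open>g\<close> and endomorphism \<open>J\<close>. For left-invariant
  \<open>X\<close>, \<open>Y\<close>, \<open>Z\<close> the functions \<open>g(Y,Z)\<close> are constant, so all terms \<open>X(g(Y,Z))\<close> vanish.
\<close>

definition lie_algebra :: "('a::real_vector \<Rightarrow> 'a \<Rightarrow> 'a) \<Rightarrow> bool" where
  "lie_algebra br \<longleftrightarrow>
     bilinear br \<and> (\<forall>X. br X X = 0) \<and>
     (\<forall>X Y Z. br X (br Y Z) + br Y (br Z X) + br Z (br X Y) = 0)"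

definition derivation :: "('a::real_vector \<Rightarrow> 'a \<Rightarrow> 'a) \<Rightarrow> ('a \<Rightarrow> 'a) \<Rightarrow> bool" where
  "derivation br D \<longleftrightarrow> linear D \<and> (\<forall>X Y. D (br X Y) = br (D X) Y + br X (D Y))"

definition pseudo_riemannian_metric :: "('a::real_vector \<Rightarrow> 'a \<Rightarrow> real) \<Rightarrow> bool" where
  "pseudo_riemannian_metric g \<longleftrightarrow>
     bilinear g \<and> (\<forall>X Y. g X Y = g Y X) \<and> (\<forall>X. (\<forall>Y. g X Y = 0) \<longrightarrow> X = 0)"

text \<open>The third vector is the timelike one, so a metric with such a basis is Lorentzian.\<close>

definition pseudo_orthonormal_basis ::
    "('a::real_vector \<Rightarrow> 'a \<Rightarrow> real) \<Rightarrow> 'a \<Rightarrow> 'a \<Rightarrow> 'a \<Rightarrow> bool" where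
  "pseudo_orthonormal_basis g e1 e2 e3 \<longleftrightarrow>
     distinct [e1, e2, e3] \<and> independent {e1, e2, e3} \<and> span {e1, e2, e3} = UNIV \<and>
     g e1 e1 = 1 \<and> g e2 e2 = 1 \<and> g e3 e3 = -1 \<and>
     g e1 e2 = 0 \<and> g e1 e3 = 0 \<and> g e2 e3 = 0 \<and>
     g e2 e1 = 0 \<and> g e3 e1 = 0 \<and> g e3 e2 = 0"

definition torsion ::
    "('a::real_vector \<Rightarrow> 'a \<Rightarrow> 'a) \<Rightarrow> ('a \<Rightarrow> 'a \<Rightarrow> 'a) \<Rightarrow> 'a \<Rightarrow> 'a \<Rightarrow> 'a" where
  "torsion br N X Y = N X Y - N Y X - br X Y"

definition curvature ::
    "('a::real_vector \<Rightarrow> 'a \<Rightarrow> 'a) \<Rightarrow> ('a \<Rightarrow> 'a \<Rightarrow> 'a) \<Rightarrow> 'a \<Rightarrow> 'a \<Rightarrow> 'a \<Rightarrow> 'a" where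
  "curvature br N X Y Z = N X (N Y Z) - N Y (N X Z) - N (br X Y) Z"

definition is_levi_civita ::
    "('a::real_vector \<Rightarrow> 'a \<Rightarrow> 'a) \<Rightarrow> ('a \<Rightarrow> 'a \<Rightarrow> real) \<Rightarrow> ('a \<Rightarrow> 'a \<Rightarrow> 'a) \<Rightarrow> bool" where
  "is_levi_civita br g N \<longleftrightarrow>
     bilinear N \<and> (\<forall>X Y. torsion br N X Y = 0) \<and>
     (\<forall>X Y Z. g (N X Y) Z + g Y (N X Z) = 0)"

definition levi_civita ::
    "('a::real_vector \<Rightarrow> 'a \<Rightarrow> 'a) \<Rightarrow> ('a \<Rightarrow> 'a \<Rightarrow> real) \<Rightarrow> 'a \<Rightarrow> 'a \<Rightarrow> 'a" where
  "levi_civita br g = (THE N. is_levi_civita br g N)"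

definition nabla_endo ::
    "('a::real_vector \<Rightarrow> 'a \<Rightarrow> 'a) \<Rightarrow> ('a \<Rightarrow> 'a) \<Rightarrow> 'a \<Rightarrow> 'a \<Rightarrow> 'a" where
  "nabla_endo N J X Y = N X (J Y) - J (N X Y)"

definition canonical_connection ::
    "('a::real_vector \<Rightarrow> 'a \<Rightarrow> 'a) \<Rightarrow> ('a \<Rightarrow> 'a \<Rightarrow> real) \<Rightarrow> ('a \<Rightarrow> 'a) \<Rightarrow> 'a \<Rightarrow> 'a \<Rightarrow> 'a" where
  "canonical_connection br g J X Y =
     levi_civita br g X Y - (1/2) *\<^sub>R nabla_endo (levi_civita br g) J X (J Y)"

definition wanas_tensor ::
    "('a::real_vector \<Rightarrow> 'a \<Rightarrow> 'a) \<Rightarrow> ('a \<Rightarrow> 'a \<Rightarrow> 'a) \<Rightarrow> 'a \<Rightarrow> 'a \<Rightarrow> 'a \<Rightarrow> 'a" where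
  "wanas_tensor br N X Y Z = curvature br N X Y Z - torsion br N (torsion br N X Y) Z"

definition wanas_trace ::
    "('a::real_vector \<Rightarrow> 'a \<Rightarrow> 'a) \<Rightarrow> ('a \<Rightarrow> 'a \<Rightarrow> real) \<Rightarrow> ('a \<Rightarrow> 'a \<Rightarrow> 'a) \<Rightarrow>
      'a \<Rightarrow> 'a \<Rightarrow> 'a \<Rightarrow> 'a \<Rightarrow> 'a \<Rightarrow> real" where
  "wanas_trace br g N e1 e2 e3 X Y =
     - g (wanas_tensor br N X e1 Y) e1 - g (wanas_tensor br N X e2 Y) e2
     + g (wanas_tensor br N X e3 Y) e3"

definition sym_wanas_trace ::
    "('a::real_vector \<Rightarrow> 'a \<Rightarrow> 'a) \<Rightarrow> ('a \<Rightarrow> 'a \<Rightarrow> real) \<Rightarrow> ('a \<Rightarrow> 'a \<Rightarrow> 'a) \<Rightarrow>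
      'a \<Rightarrow> 'a \<Rightarrow> 'a \<Rightarrow> 'a \<Rightarrow> 'a \<Rightarrow> real" where
  "sym_wanas_trace br g N e1 e2 e3 X Y =
     (1/2) * (wanas_trace br g N e1 e2 e3 X Y + wanas_trace br g N e1 e2 e3 Y X)"

definition sym_wanas_operator ::
    "('a::real_vector \<Rightarrow> 'a \<Rightarrow> 'a) \<Rightarrow> ('a \<Rightarrow> 'a \<Rightarrow> real) \<Rightarrow> ('a \<Rightarrow> 'a \<Rightarrow> 'a) \<Rightarrow>
      'a \<Rightarrow> 'a \<Rightarrow> 'a \<Rightarrow> 'a \<Rightarrow> 'a" where
  "sym_wanas_operator br g N e1 e2 e3 =
     (THE P. \<forall>X Y. sym_wanas_trace br g N e1 e2 e3 X Y = g (P X) Y)"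

definition second_kind_wanas_decomposition ::
    "('a::real_vector \<Rightarrow> 'a \<Rightarrow> 'a) \<Rightarrow> ('a \<Rightarrow> 'a \<Rightarrow> real) \<Rightarrow> ('a \<Rightarrow> 'a \<Rightarrow> 'a) \<Rightarrow>
      'a \<Rightarrow> 'a \<Rightarrow> 'a \<Rightarrow> real \<Rightarrow> ('a \<Rightarrow> 'a) \<Rightarrow> bool" where
  "second_kind_wanas_decomposition br g N e1 e2 e3 c D \<longleftrightarrow>
     derivation br D \<and> (\<forall>X. sym_wanas_operator br g N e1 e2 e3 X = c *\<^sub>R X + D X)"

definition second_kind_algebraic_wanas_soliton ::
    "('a::real_vector \<Rightarrow> 'a \<Rightarrow> 'a) \<Rightarrow> ('a \<Rightarrow> 'a \<Rightarrow> real) \<Rightarrow> ('a \<Rightarrow> 'a \<Rightarrow> 'a) \<Rightarrow>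
      'a \<Rightarrow> 'a \<Rightarrow> 'a \<Rightarrow> real \<Rightarrow> bool" where
  "second_kind_algebraic_wanas_soliton br g N e1 e2 e3 c \<longleftrightarrow>
     (\<exists>D. second_kind_wanas_decomposition br g N e1 e2 e3 c D)"

end

theory Submission
  imports Defs
begin

text \<open>
  The Koszul formula makes everything explicit on the frame: the symmetrised Wanas operator is
  \<open>x\<close> on \<open>e\<^sub>1\<close> and a matrix \<open>S\<close> on the abelian ideal spanned by \<open>e\<^sub>2, e\<^sub>3\<close>. Let \<open>A\<close> be the action
  of \<open>ad e\<^sub>1\<close> on this ideal. Then \<open>D = Wan - c Id\<close> is a derivation iff \<open>[S, A] = (x - c) A\<close>. Taking
  traces, \<open>tr A = \<alpha> + \<delta> \<noteq> 0\<close> forces \<open>c = x\<close>, and then \<open>S\<close> commutes with \<open>A\<close>, which together with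
  \<open>\<alpha>\<gamma> = \<beta>\<delta>\<close> is only possible for \<open>\<beta> = \<gamma> = 0\<close>. Alternative (iii) contradicts \<open>\<alpha> + \<delta> \<noteq> 0\<close>,
  so it never occurs.
\<close>

lemma bilinear_iff:
  "bilinear f \<longleftrightarrow>
     (\<forall>x y z. f (x + y) z = f x z + f y z) \<and> (\<forall>r x z. f (r *\<^sub>R x) z = r *\<^sub>R f x z) \<and>
     (\<forall>x y z. f x (y + z) = f x y + f x z) \<and> (\<forall>r x z. f x (r *\<^sub>R z) = r *\<^sub>R f x z)"
  unfolding bilinear_def linear_iff by auto

lemmas bilinear_expand =
  bilinear_ladd bilinear_radd bilinear_lmul bilinear_rmul bilinear_lsub bilinear_rsub
  bilinear_lneg bilinear_rneg bilinear_lzero bilinear_rzero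

text \<open>The Koszul expression for g(nabla_X Y, Z): for left-invariant fields the derivative
  terms vanish and only the brackets remain.\<close>

definition koszul ::
    "('a::real_vector \<Rightarrow> 'a \<Rightarrow> 'a) \<Rightarrow> ('a \<Rightarrow> 'a \<Rightarrow> real) \<Rightarrow> 'a \<Rightarrow> 'a \<Rightarrow> 'a \<Rightarrow> real" where
  "koszul br g X Y Z = (g (br X Y) Z - g (br Y Z) X + g (br Z X) Y) / 2"

section \<open>Linear algebra in a pseudo-orthonormal frame\<close>

locale lie_algebra_frame =
  fixes br :: "'a::real_vector \<Rightarrow> 'a \<Rightarrow> 'a"
    and g :: "'a \<Rightarrow> 'a \<Rightarrow> real"
    and e1 e2 e3 :: 'a
  assumes lie: "lie_algebra br"
    and metric: "pseudo_riemannian_metric g"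
    and frame: "pseudo_orthonormal_basis g e1 e2 e3"
begin

lemma bilinear_br: "bilinear br"
  and br_self: "br X X = 0"
  using lie by (auto simp: lie_algebra_def)

lemma bilinear_g: "bilinear g"
  and g_sym: "g X Y = g Y X"
  using metric by (auto simp: pseudo_riemannian_metric_def)

lemmas br_expand = bilinear_expand[OF bilinear_br]
lemmas g_expand = bilinear_expand[OF bilinear_g]

lemma br_antisym: "br X Y = - br Y X"
proof -
  have "br (X + Y) (X + Y) = br X Y + br Y X"
    unfolding bilinear_ladd[OF bilinear_br] bilinear_radd[OF bilinear_br] by (simp add: br_self)
  then have "br X Y + br Y X = 0"
    by (simp add: br_self)
  then show ?thesis
    by (simp add: eq_neg_iff_add_eq_0)
qed

lemma g_frame:
  "g e1 e1 = 1" "g e2 e2 = 1" "g e3 e3 = -1" "g e1 e2 = 0" "g e1 e3 = 0" "g e2 e3 = 0"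
  "g e2 e1 = 0" "g e3 e1 = 0" "g e3 e2 = 0"
  using frame by (auto simp: pseudo_orthonormal_basis_def)

lemma span_frame: "span {e1, e2, e3} = UNIV"
  using frame by (auto simp: pseudo_orthonormal_basis_def)

lemma g_eqI:
  assumes "\<And>Z. g X Z = g Y Z"
  shows "X = Y"
proof -
  have "g (X - Y) Z = 0" for Z
    using assms by (simp add: g_expand)
  then show ?thesis
    using metric by (metis pseudo_riemannian_metric_def right_minus_eq)
qed

text \<open>By nondegeneracy it is enough to pair both sides with the frame. The minus sign comes
  from \<open>g e3 e3 = -1\<close> and returns whenever a vector is rebuilt from its
  pairings.\<close>

lemma frame_expansion: "X = g X e1 *\<^sub>R e1 + g X e2 *\<^sub>R e2 - g X e3 *\<^sub>R e3"
proof (rule g_eqI)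
  fix Z
  let ?Y = "g X e1 *\<^sub>R e1 + g X e2 *\<^sub>R e2 - g X e3 *\<^sub>R e3"
  have "linear (g X)" "linear (g ?Y)"
    using bilinear_g by (auto simp: bilinear_def)
  then show "g X Z = g ?Y Z"
    by (rule linear_eq_on[where B = "{e1, e2, e3}"])
      (auto simp: span_frame g_expand g_frame)
qed

lemma frame_eqI:
  assumes "g X e1 = g Y e1" "g X e2 = g Y e2" "g X e3 = g Y e3"
  shows "X = Y"
  using frame_expansion[of X] frame_expansion[of Y] assms by simp

lemma frame_bilinear_eqI:
  assumes "bilinear (f :: 'a \<Rightarrow> 'a \<Rightarrow> 'b::real_vector)" "bilinear h"
    and "\<And>x y. x \<in> {e1, e2, e3} \<Longrightarrow> y \<in> {e1, e2, e3} \<Longrightarrow> f x y = h x y"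
  shows "f X Y = h X Y"
  by (rule bilinear_eq[OF assms(1,2), where B = "{e1, e2, e3}" and C = "{e1, e2, e3}"])
    (use assms(3) in \<open>auto simp: span_frame\<close>)

section \<open>The Levi-Civita connection\<close>

lemma koszul_formula:
  assumes "is_levi_civita br g N"
  shows "g (N X Y) Z = koszul br g X Y Z"
proof -
  have met: "g (N U V) W + g (N U W) V = 0" for U V W
    using assms g_sym by (metis is_levi_civita_def)
  have "br U V = N U V - N V U" for U V
    using assms by (simp add: is_levi_civita_def torsion_def)
  then have tor: "g (br U V) W = g (N U V) W - g (N V U) W" for U V W
    by (simp add: g_expand)
  \<comment> \<open>\<open>tor\<close> turns the three brackets into six terms; by metric
    compatibility four of them cancel in pairs and the other two are equal.\<close>
  show ?thesis
    unfolding koszul_def tor using met[of X Y Z] met[of Y Z X] met[of Z X Y]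
    by (simp add: field_simps)
qed

text \<open>The vector representing the functional \<open>koszul br g X Y\<close>. It is the witness
  for existence, while \<open>koszul_formula\<close> gives uniqueness; together they justify the
  definite description in \<open>levi_civita\<close>.\<close>

definition koszul_connection :: "'a \<Rightarrow> 'a \<Rightarrow> 'a" where
  "koszul_connection X Y =
     koszul br g X Y e1 *\<^sub>R e1 + koszul br g X Y e2 *\<^sub>R e2 - koszul br g X Y e3 *\<^sub>R e3"

lemma g_koszul_connection: "g (koszul_connection X Y) Z = koszul br g X Y Z"
proof -
  have "linear (g (koszul_connection X Y))" "linear (koszul br g X Y)"
    by (auto simp: linear_iff koszul_def br_expand g_expand field_simps)
  then show ?thesis
    by (rule linear_eq_on[where B = "{e1, e2, e3}"])
      (auto simp: span_frame koszul_connection_def g_expand g_frame)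
qed

lemma is_levi_civita_koszul_connection: "is_levi_civita br g koszul_connection"
  unfolding is_levi_civita_def
proof (intro conjI allI)
  show "bilinear koszul_connection"
    unfolding bilinear_iff
    by (auto intro!: g_eqI simp: g_expand g_koszul_connection)
      (auto simp: koszul_def br_expand g_expand field_simps)
  show "torsion br koszul_connection X Y = 0" for X Y
  proof (rule g_eqI)
    fix Z
    show "g (torsion br koszul_connection X Y) Z = g 0 Z"
      using br_antisym[of X Y] br_antisym[of Y Z] br_antisym[of Z X]
      by (simp add: torsion_def g_expand g_koszul_connection koszul_def field_simps)
  qed
  show "g (koszul_connection X Y) Z + g Y (koszul_connection X Z) = 0" for X Y Z
    using br_antisym[of X Y] br_antisym[of Y Z] br_antisym[of Z X]
    by (simp add: g_sym[of Y] g_koszul_connection koszul_def g_expand field_simps)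
qed

lemma is_levi_civita_levi_civita: "is_levi_civita br g (levi_civita br g)"
  unfolding levi_civita_def
proof (rule theI[where P = "is_levi_civita br g", OF is_levi_civita_koszul_connection])
  fix N
  assume "is_levi_civita br g N"
  then show "N = koszul_connection"
    by (intro ext g_eqI) (simp add: koszul_formula g_koszul_connection)
qed

lemma bilinear_levi_civita: "bilinear (levi_civita br g)"
  using is_levi_civita_levi_civita by (simp add: is_levi_civita_def)

section \<open>The canonical connection and the Wanas operator\<close>

lemma bilinear_canonical_connection:
  assumes "linear J"
  shows "bilinear (canonical_connection br g J)"
  unfolding bilinear_iff canonical_connection_def nabla_endo_def
  by (auto simp: bilinear_expand[OF bilinear_levi_civita] linear_add[OF assms]
      linear_scale[OF assms] linear_diff[OF assms] algebra_simps)

lemma bilinear_sym_wanas_trace: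
  assumes "bilinear N"
  shows "bilinear (sym_wanas_trace br g N e1 e2 e3)"
  unfolding bilinear_iff sym_wanas_trace_def wanas_trace_def wanas_tensor_def curvature_def
    torsion_def
  by (auto simp: bilinear_expand[OF assms] br_expand g_expand algebra_simps)

text \<open>Bilinearity makes each \<open>w X\<close> a linear functional, which the frame turns
  into a vector; nondegeneracy makes this vector unique, as the definite description
  requires.\<close>

lemma sym_wanas_operator_expansion:
  assumes "bilinear N"
  defines "w \<equiv> sym_wanas_trace br g N e1 e2 e3"
  shows "sym_wanas_operator br g N e1 e2 e3 X =
    w X e1 *\<^sub>R e1 + w X e2 *\<^sub>R e2 - w X e3 *\<^sub>R e3"
proof -
  define P where "P X = w X e1 *\<^sub>R e1 + w X e2 *\<^sub>R e2 - w X e3 *\<^sub>R e3" for X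
  have lin: "linear (w X)" "linear (g (P X))" for X
    using bilinear_sym_wanas_trace[OF assms(1)] bilinear_g by (auto simp: bilinear_def w_def)
  have P: "w X Y = g (P X) Y" for X Y
    by (rule linear_eq_on[OF lin, where B = "{e1, e2, e3}"])
      (auto simp: span_frame P_def g_expand g_frame)
  have "sym_wanas_operator br g N e1 e2 e3 = P"
    unfolding sym_wanas_operator_def w_def[symmetric]
  proof (rule the_equality)
    fix Q
    assume "\<forall>X Y. w X Y = g (Q X) Y"
    then show "Q = P"
      using P by (intro ext g_eqI) metis
  qed (simp add: P)
  then show ?thesis
    by (simp add: P_def)
qed

lemma linear_sym_wanas_operator:
  assumes "bilinear N"
  shows "linear (sym_wanas_operator br g N e1 e2 e3)"
  unfolding linear_iff sym_wanas_operator_expansion[OF assms]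
  by (auto simp: bilinear_expand[OF bilinear_sym_wanas_trace[OF assms]] algebra_simps)

text \<open>Both sides of the Leibniz rule are bilinear, so nine pairs of frame vectors suffice.
  Equal entries are trivial and swapped entries follow by antisymmetry, which leaves three.\<close>

lemma derivation_frameI:
  assumes "linear D"
    and "D (br e1 e2) = br (D e1) e2 + br e1 (D e2)"
    and "D (br e1 e3) = br (D e1) e3 + br e1 (D e3)"
    and "D (br e2 e3) = br (D e2) e3 + br e2 (D e3)"
  shows "derivation br D"
proof -
  have anti: "D (br Y X) = br (D Y) X + br Y (D X)" if "D (br X Y) = br (D X) Y + br X (D Y)" for X Y
  proof -
    have "br Y X = - br X Y" "br (D Y) X = - br X (D Y)" "br Y (D X) = - br (D X) Y"
      by (rule br_antisym)+
    then show ?thesis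
      by (simp add: linear_neg[OF assms(1)] that)
  qed
  have same: "D (br X X) = br (D X) X + br X (D X)" for X
    using br_antisym[of "D X" X] by (simp add: br_self linear_0[OF assms(1)])
  have "D (br X Y) = br (D X) Y + br X (D Y)" for X Y
    by (rule frame_bilinear_eqI[where f = "\<lambda>X Y. D (br X Y)"
          and h = "\<lambda>X Y. br (D X) Y + br X (D Y)"])
      (use same assms(2-) anti in \<open>auto simp: bilinear_iff br_expand linear_add[OF assms(1)]
        linear_scale[OF assms(1)] scaleR_add_right\<close>)
  then show ?thesis
    using assms(1) by (simp add: derivation_def)
qed

end

section \<open>Connections and Wanas operator of the given Lie algebra in the frame\<close>

locale G6 = lie_algebra_frame +
  fixes J :: "'a \<Rightarrow> 'a" and \<alpha> \<beta> \<gamma> \<delta> :: real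
  assumes br12: "br e1 e2 = \<alpha> *\<^sub>R e2 + \<beta> *\<^sub>R e3"
    and br13: "br e1 e3 = \<gamma> *\<^sub>R e2 + \<delta> *\<^sub>R e3"
    and br23: "br e2 e3 = 0"
    and lin_J: "linear J" and Je1: "J e1 = e1" and Je2: "J e2 = e2" and Je3: "J e3 = - e3"
begin

abbreviation "N0 \<equiv> canonical_connection br g J"
abbreviation "w \<equiv> sym_wanas_trace br g N0 e1 e2 e3"
abbreviation "Wan \<equiv> sym_wanas_operator br g N0 e1 e2 e3"

lemma br_frame:
  "br e1 e1 = 0" "br e2 e2 = 0" "br e3 e3 = 0"
  "br e1 e2 = \<alpha> *\<^sub>R e2 + \<beta> *\<^sub>R e3" "br e2 e1 = - (\<alpha> *\<^sub>R e2) - \<beta> *\<^sub>R e3"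
  "br e1 e3 = \<gamma> *\<^sub>R e2 + \<delta> *\<^sub>R e3" "br e3 e1 = - (\<gamma> *\<^sub>R e2) - \<delta> *\<^sub>R e3"
  "br e2 e3 = 0" "br e3 e2 = 0"
  using br_antisym[of e2 e1] br_antisym[of e3 e1] br_antisym[of e3 e2]
  by (simp_all add: br_self br12 br13 br23)

lemma bilinear_N0: "bilinear N0"
  by (rule bilinear_canonical_connection[OF lin_J])

lemma levi_civita_frame:
  defines "N \<equiv> levi_civita br g"
  shows "N e1 e1 = 0" "N e1 e2 = ((\<beta> + \<gamma>) / 2) *\<^sub>R e3" "N e1 e3 = ((\<beta> + \<gamma>) / 2) *\<^sub>R e2"
    "N e2 e1 = ((\<gamma> - \<beta>) / 2) *\<^sub>R e3 - \<alpha> *\<^sub>R e2" "N e2 e2 = \<alpha> *\<^sub>R e1"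
    "N e2 e3 = ((\<gamma> - \<beta>) / 2) *\<^sub>R e1"
    "N e3 e1 = ((\<beta> - \<gamma>) / 2) *\<^sub>R e2 - \<delta> *\<^sub>R e3" "N e3 e2 = ((\<gamma> - \<beta>) / 2) *\<^sub>R e1"
    "N e3 e3 = - (\<delta> *\<^sub>R e1)"
  by (rule frame_eqI;
      simp add: N_def koszul_formula[OF is_levi_civita_levi_civita] koszul_def br_frame g_expand
        g_frame field_simps)+

text \<open>As J^2 = Id, \<open>N0 X Y\<close> is half the sum of nabla_X Y and J(nabla_X(JY)), the
  part of nabla_X that preserves the eigenspaces of \<open>J\<close>. Hence all terms mixing
  \<open>e3\<close> with the span of \<open>e1\<close>, \<open>e2\<close> drop out.\<close>

lemma N0_frame:
  "N0 e1 e1 = 0" "N0 e1 e2 = 0" "N0 e1 e3 = 0"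
  "N0 e2 e1 = - (\<alpha> *\<^sub>R e2)" "N0 e2 e2 = \<alpha> *\<^sub>R e1" "N0 e2 e3 = 0"
  "N0 e3 e1 = ((\<beta> - \<gamma>) / 2) *\<^sub>R e2" "N0 e3 e2 = ((\<gamma> - \<beta>) / 2) *\<^sub>R e1" "N0 e3 e3 = 0"
  unfolding canonical_connection_def nabla_endo_def
  by (rule frame_eqI;
      simp add: levi_civita_frame bilinear_expand[OF bilinear_levi_civita] Je1 Je2 Je3
        linear_add[OF lin_J] linear_diff[OF lin_J] linear_scale[OF lin_J] linear_neg[OF lin_J]
        linear_0[OF lin_J] g_expand g_frame field_simps)+

lemma w_frame:
  "w e1 e1 = - (\<alpha>\<^sup>2 + \<delta>\<^sup>2 + \<beta>\<^sup>2 / 2 + 3 * \<beta> * \<gamma> / 2)"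
  "w e2 e2 = - \<alpha>\<^sup>2 - \<beta>\<^sup>2 / 2 + \<beta> * \<gamma> / 2"
  "w e3 e3 = (\<beta>\<^sup>2 - \<gamma>\<^sup>2) / 2"
  "w e1 e2 = 0" "w e2 e1 = 0" "w e1 e3 = 0" "w e3 e1 = 0"
  "w e2 e3 = ((\<gamma> - \<beta>) * \<delta> - 2 * \<alpha> * \<gamma>) / 4"
  "w e3 e2 = ((\<gamma> - \<beta>) * \<delta> - 2 * \<alpha> * \<gamma>) / 4"
  unfolding sym_wanas_trace_def wanas_trace_def wanas_tensor_def curvature_def torsion_def
  by (simp_all add: br_frame N0_frame bilinear_expand[OF bilinear_N0] br_expand g_expand g_frame
      field_simps power2_eq_square)

text \<open>Raising the index flips the sign of the \<open>e3\<close> components, so the two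
  off-diagonal entries are opposite although \<open>w\<close> is symmetric.\<close>

lemma Wan_frame:
  "Wan e1 = - (\<alpha>\<^sup>2 + \<delta>\<^sup>2 + \<beta>\<^sup>2 / 2 + 3 * \<beta> * \<gamma> / 2) *\<^sub>R e1"
  "Wan e2 = (- \<alpha>\<^sup>2 - \<beta>\<^sup>2 / 2 + \<beta> * \<gamma> / 2) *\<^sub>R e2 - (((\<gamma> - \<beta>) * \<delta> - 2 * \<alpha> * \<gamma>) / 4) *\<^sub>R e3"
  "Wan e3 = (((\<gamma> - \<beta>) * \<delta> - 2 * \<alpha> * \<gamma>) / 4) *\<^sub>R e2 - ((\<beta>\<^sup>2 - \<gamma>\<^sup>2) / 2) *\<^sub>R e3"
  unfolding sym_wanas_operator_expansion[OF bilinear_N0] by (simp_all add: w_frame)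

end

text \<open>
  The last three hypotheses say that the matrices with rows \<open>(a, c), (b, d)\<close> and \<open>(y, z), (-z, v)\<close>
  commute.
\<close>

lemma commuting_constraints:
  fixes a b c d x y z v :: real
  assumes "a + d \<noteq> 0" "a * c - b * d = 0"
    and y: "y = - a\<^sup>2 - b\<^sup>2 / 2 + b * c / 2"
    and z: "z = ((c - b) * d - 2 * a * c) / 4"
    and v: "v = (c\<^sup>2 - b\<^sup>2) / 2"
    and e1: "z * (b + c) = 0"
    and e2: "b * (v - y) = z * (a - d)"
    and e3: "c * (y - v) = z * (a - d)"
  shows "b = 0" "c = 0"
proof -
  have zd: "4 * z = d * (c - 3 * b)"
    using assms(2) z by algebra
  have yv: "2 * (y - v) = - 2 * a\<^sup>2 + b * c - c\<^sup>2"
    using y v by algebra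
  have b: "b = 0"
  proof (rule ccontr)
    assume "b \<noteq> 0"
    \<comment> \<open>Otherwise \<open>e1\<close> gives c = -b, and then a c = b d contradicts a + d
      being nonzero.\<close>
    have "z = 0"
    proof (rule ccontr)
      assume "z \<noteq> 0"
      then have "c = - b" using e1 by auto
      then have "b * (a + d) = 0" using assms(2) by algebra
      then show False using \<open>b \<noteq> 0\<close> assms(1) by simp
    qed
    then have yv0: "2 * a\<^sup>2 - b * c + c\<^sup>2 = 0"
      using e2 \<open>b \<noteq> 0\<close> yv by simp
    \<comment> \<open>Since z = 0, \<open>zd\<close> leaves d = 0 or c = 3 b. In either case
      \<open>yv0\<close> becomes a vanishing sum of squares with a nonzero term.\<close>
    show False
    proof (cases "d = 0")
      case True
      then have "a \<noteq> 0" "c = 0" using assms(1,2) by auto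
      then show False using yv0 by simp
    next
      case False
      then have "c = 3 * b" using zd \<open>z = 0\<close> by simp
      then have "2 * a\<^sup>2 + 6 * b\<^sup>2 = 0" using yv0 by algebra
      then show False using \<open>b \<noteq> 0\<close> by (smt (verit) zero_le_power2 zero_less_power2)
    qed
  qed
  show "b = 0" by (fact b)
  show "c = 0"
  proof (rule ccontr)
    assume "c \<noteq> 0"
    \<comment> \<open>With b = 0 the constraints read a c = 0 and z c = 0. Then \<open>zd\<close>
      gives d c = 0, so a and d would both vanish.\<close>
    then have "a = 0" "z = 0" using assms(2) e1 b by auto
    then show False using zd b \<open>c \<noteq> 0\<close> assms(1) by auto
  qed
qed

section \<open>Soliton decompositions\<close>

context G6
begin

lemma decomposition_components:
  assumes "second_kind_wanas_decomposition br g N0 e1 e2 e3 c D"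
    and "\<alpha> + \<delta> \<noteq> 0" "\<alpha> * \<gamma> - \<beta> * \<delta> = 0"
  shows "\<beta> = 0" "\<gamma> = 0" "\<alpha>\<^sup>2 + \<delta>\<^sup>2 + c = 0"
    and "D e1 = 0" "D e2 = \<delta>\<^sup>2 *\<^sub>R e2" "D e3 = (\<alpha>\<^sup>2 + \<delta>\<^sup>2) *\<^sub>R e3"
proof -
  define x y z v where
    x: "x = - (\<alpha>\<^sup>2 + \<delta>\<^sup>2 + \<beta>\<^sup>2 / 2 + 3 * \<beta> * \<gamma> / 2)" and
    y: "y = - \<alpha>\<^sup>2 - \<beta>\<^sup>2 / 2 + \<beta> * \<gamma> / 2" and
    z: "z = ((\<gamma> - \<beta>) * \<delta> - 2 * \<alpha> * \<gamma>) / 4" and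
    v: "v = (\<gamma>\<^sup>2 - \<beta>\<^sup>2) / 2"
  have lin: "linear D" and der: "\<And>X Y. D (br X Y) = br (D X) Y + br X (D Y)"
    and D: "\<And>X. D X = Wan X - c *\<^sub>R X"
    using assms(1) by (auto simp: second_kind_wanas_decomposition_def derivation_def)
  have De: "D e1 = (x - c) *\<^sub>R e1" "D e2 = (y - c) *\<^sub>R e2 - z *\<^sub>R e3"
    "D e3 = z *\<^sub>R e2 + (v - c) *\<^sub>R e3"
    unfolding D
    by (rule frame_eqI; simp add: Wan_frame x y z v g_expand g_frame field_simps)+
  have D12: "D (\<alpha> *\<^sub>R e2 + \<beta> *\<^sub>R e3) = br (D e1) e2 + br e1 (D e2)"
    and D13: "D (\<gamma> *\<^sub>R e2 + \<delta> *\<^sub>R e3) = br (D e1) e3 + br e1 (D e3)"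
    using der[of e1 e2] der[of e1 e3] by (simp_all add: br_frame)
  note simps = linear_add[OF lin] linear_scale[OF lin] De br_expand br_frame g_expand g_frame
  \<comment> \<open>The four entries of [S, A] = (x - c) A. The bracket of \<open>e2\<close> and
    \<open>e3\<close> gives no condition, because \<open>D\<close> preserves the abelian ideal they
    span.\<close>
  have eqs: "\<alpha> * (y - c) + \<beta> * z = (x - c) * \<alpha> + (y - c) * \<alpha> - z * \<gamma>"
    "- \<alpha> * z + \<beta> * (v - c) = (x - c) * \<beta> + (y - c) * \<beta> - z * \<delta>"
    "\<gamma> * (y - c) + \<delta> * z = (x - c) * \<gamma> + z * \<alpha> + (v - c) * \<gamma>"
    "- \<gamma> * z + \<delta> * (v - c) = (x - c) * \<delta> + z * \<beta> + (v - c) * \<delta>"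
    using arg_cong[OF D12, of "\<lambda>X. g X e2"] arg_cong[OF D12, of "\<lambda>X. g X e3"]
      arg_cong[OF D13, of "\<lambda>X. g X e2"] arg_cong[OF D13, of "\<lambda>X. g X e3"]
    unfolding simps by (simp_all add: simps algebra_simps)
  \<comment> \<open>Sum of the two diagonal entries: a commutator has trace zero.\<close>
  have "(x - c) * (\<alpha> + \<delta>) = 0"
    using eqs(1,4) by (simp add: algebra_simps)
  then have xc: "x = c"
    using assms(2) by simp
  have "z * (\<beta> + \<gamma>) = 0" "\<beta> * (v - y) = z * (\<alpha> - \<delta>)" "\<gamma> * (y - v) = z * (\<alpha> - \<delta>)"
    using eqs by (simp_all add: xc algebra_simps)
  note zero = commuting_constraints[OF assms(2,3) y z v this]
  then show "\<beta> = 0" "\<gamma> = 0" "\<alpha>\<^sup>2 + \<delta>\<^sup>2 + c = 0"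
    using x xc by simp_all
  then have "c = - (\<alpha>\<^sup>2 + \<delta>\<^sup>2)"
    by simp
  with zero show "D e1 = 0" "D e2 = \<delta>\<^sup>2 *\<^sub>R e2" "D e3 = (\<alpha>\<^sup>2 + \<delta>\<^sup>2) *\<^sub>R e3"
    unfolding De xc by (simp_all add: y z v)
qed

text \<open>For \<beta> = \<gamma> = 0 both \<open>Wan\<close> and ad e1 are diagonal in the frame,
  and \<open>c\<close> is the eigenvalue of \<open>Wan\<close> on \<open>e1\<close>. So the
  difference kills \<open>e1\<close> and commutes with ad e1.\<close>

lemma decomposition_exists:
  assumes "\<beta> = 0" "\<gamma> = 0" "\<alpha>\<^sup>2 + \<delta>\<^sup>2 + c = 0"
  shows "second_kind_wanas_decomposition br g N0 e1 e2 e3 c (\<lambda>X. Wan X - c *\<^sub>R X)"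
proof -
  define D where "D = (\<lambda>X. Wan X - c *\<^sub>R X)"
  have lin: "linear D"
    using linear_sym_wanas_operator[OF bilinear_N0] by (auto simp: linear_iff D_def algebra_simps)
  have c: "c = - (\<alpha>\<^sup>2 + \<delta>\<^sup>2)"
    using assms(3) by simp
  have De: "D e1 = 0" "D e2 = \<delta>\<^sup>2 *\<^sub>R e2" "D e3 = (\<alpha>\<^sup>2 + \<delta>\<^sup>2) *\<^sub>R e3"
    by (simp_all add: D_def Wan_frame assms(1,2) c algebra_simps)
  have "derivation br D"
    by (rule derivation_frameI[OF lin])
      (simp_all add: br_frame assms(1,2) linear_scale[OF lin] linear_0[OF lin] De br_expand)
  then show ?thesis
    by (simp add: second_kind_wanas_decomposition_def D_def)
qed

end

theorem theorem3p7:
  fixes br :: "'a::real_vector \<Rightarrow> 'a \<Rightarrow> 'a"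
    and g :: "'a \<Rightarrow> 'a \<Rightarrow> real"
    and J :: "'a \<Rightarrow> 'a"
    and e1 e2 e3 :: 'a
    and \<alpha> \<beta> \<gamma> \<delta> c :: real
  assumes "\<alpha> + \<delta> \<noteq> 0"
    and "\<alpha> * \<gamma> - \<beta> * \<delta> = 0"
    and "lie_algebra br"
    and "pseudo_riemannian_metric g"
    and "pseudo_orthonormal_basis g e1 e2 e3"
    and "br e1 e2 = \<alpha> *\<^sub>R e2 + \<beta> *\<^sub>R e3"
    and "br e1 e3 = \<gamma> *\<^sub>R e2 + \<delta> *\<^sub>R e3"
    and "br e2 e3 = 0"
    and "linear J" and "J e1 = e1" and "J e2 = e2" and "J e3 = - e3"
  shows
    "(second_kind_algebraic_wanas_soliton br g (canonical_connection br g J) e1 e2 e3 c \<longleftrightarrow>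
        (\<alpha> \<noteq> 0 \<and> \<beta> = 0 \<and> \<gamma> = 0 \<and> \<delta> = 0 \<and> \<alpha>\<^sup>2 + c = 0)
      \<or> (\<beta> = 0 \<and> \<gamma> = 0 \<and> \<alpha>\<^sup>2 + \<delta>\<^sup>2 + c = 0 \<and> \<delta> \<noteq> 0 \<and> \<alpha> + \<delta> \<noteq> 0)
      \<or> (\<beta> \<noteq> 0 \<and> \<delta> \<noteq> 0 \<and> \<gamma> = - \<beta> \<and> \<delta> = - \<alpha> \<and> \<alpha>\<^sup>2 = \<beta>\<^sup>2 \<and> \<alpha>\<^sup>2 + c = 0))
     \<and> (\<forall>D. second_kind_wanas_decomposition br g (canonical_connection br g J) e1 e2 e3 c D \<longrightarrow>
        (\<alpha> \<noteq> 0 \<and> \<beta> = 0 \<and> \<gamma> = 0 \<and> \<delta> = 0 \<and> \<alpha>\<^sup>2 + c = 0 \<longrightarrow>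
           D e1 = 0 \<and> D e2 = 0 \<and> D e3 = \<alpha>\<^sup>2 *\<^sub>R e3)
      \<and> (\<beta> = 0 \<and> \<gamma> = 0 \<and> \<alpha>\<^sup>2 + \<delta>\<^sup>2 + c = 0 \<and> \<delta> \<noteq> 0 \<and> \<alpha> + \<delta> \<noteq> 0 \<longrightarrow>
           D e1 = 0 \<and> D e2 = \<delta>\<^sup>2 *\<^sub>R e2 \<and> D e3 = (\<alpha>\<^sup>2 + \<delta>\<^sup>2) *\<^sub>R e3)
      \<and> (\<beta> \<noteq> 0 \<and> \<delta> \<noteq> 0 \<and> \<gamma> = - \<beta> \<and> \<delta> = - \<alpha> \<and> \<alpha>\<^sup>2 = \<beta>\<^sup>2 \<and> \<alpha>\<^sup>2 + c = 0 \<longrightarrow>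
           D e1 = 0 \<and> D e2 = - (\<alpha>\<^sup>2 *\<^sub>R e2) - (\<alpha> * \<beta>) *\<^sub>R e3
           \<and> D e3 = (\<alpha> * \<beta>) *\<^sub>R e2 + \<alpha>\<^sup>2 *\<^sub>R e3))"
proof -
  interpret G6 br g e1 e2 e3 J \<alpha> \<beta> \<gamma> \<delta>
    by (intro G6.intro lie_algebra_frame.intro G6_axioms.intro assms)
  note components = decomposition_components[OF _ assms(1,2)]
  have "second_kind_algebraic_wanas_soliton br g N0 e1 e2 e3 c \<longleftrightarrow>
      \<beta> = 0 \<and> \<gamma> = 0 \<and> \<alpha>\<^sup>2 + \<delta>\<^sup>2 + c = 0"
    unfolding second_kind_algebraic_wanas_soliton_def
    using components(1-3) decomposition_exists by blast
  \<comment> \<open>The cases \<delta> = 0, where \<alpha> is nonzero, and \<delta> nonzero are (i)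
    and (ii); the formulas for \<open>D\<close> in (i) are those of (ii) at \<delta> = 0. In (iii)
    they hold vacuously, as \<delta> = -\<alpha> is excluded.\<close>
  then show ?thesis
    using assms(1) components(4-6) by auto
qed

end
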